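(* Let $C=(I,V,E,O)$ be a CDAG and let $S\ge 1$ be the number of red pebbles. Let $\{V_1,\dots,V_p\}$ be an arbitrary (not necessarily acyclic) partition of $V$ into pairwise disjoint sets with $\bigcup_{i=1}^p V_i=V$, and let $C_1,\dots,C_p$ be the induced sub-CDAGs $C_i=(I_i,V_i,E_i,O_i)$ with $I_i=I\cap V_i$, $E_i=E\cap(V_i\times V_i)$, $O_i=O\cap V_i$. If $Q$ is the I/O complexity of $C$ and $Q_i$ is the I/O complexity of $C_i$ (all with $S$ red pebbles, in the red-blue pebble game with flexible input/output labeling described in the context), then $\sum_{i=1}^p Q_i\le Q$. In particular, if $L_i$ is an I/O lower bound for $C_i$ for each $i$, then $\sum_{i=1}^p L_i$ is an I/O lower bound for $C$.
   Context: A CDAG (computational directed acyclic graph) is a 4-tuple $C=(I,V,E,O)$ of finite sets such that $E\subseteq V\times V$, $(V,E)$ is a directed acyclic graph, $I\subseteq V$ (the input set) consists of vertices with no incoming edges, and $O\subseteq V$ is the output set. (Flexible labeling: vertices with no predecessors need not belong to $I$, and vertices with no successors need not belong to $O$.) Red-blue pebble game with flexible input/output labeling: given $S$ red pebbles and arbitrarily many blue pebbles, start with a blue pebble on each vertex of $I$ and no other pebbles. Allowed moves: R1 (input) place a red pebble on any vertex carrying a blue pebble; R2 (output) place a blue pebble on any vertex carrying a red pebble; R3 (compute) if all immediate predecessors of a vertex $v\in V\setminus I$ carry red pebbles (vacuously true if $v$ has no predecessors), a red pebble may be placed on (or moved from a predecessor to) $v$; R4 (delete) remove a red pebble from any vertex.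 At no time may more than $S$ red pebbles be on the graph. A complete calculation is a finite sequence of moves in which every vertex of $V\setminus I$ is fired (receives a red pebble by R3) at least once and which ends with blue pebbles on all vertices of $O$. Its cost is the number of R1 and R2 moves. The I/O complexity of $C$ is the minimum cost over all complete calculations; an I/O lower bound is any number not exceeding it. *)

theory Defs
  imports
    "HOL-Library.Extended_Nat"
    "HOL-Library.Extended_Real"
    "HOL-Library.Disjoint_Sets"
begin

record 'a cdag =
  inputs :: "'a set"
  verts :: "'a set"
  edges :: "('a \<times> 'a) set"
  outputs :: "'a set"

definition is_cdag :: "'a cdag \<Rightarrow> bool" where
  "is_cdag C \<longleftrightarrow>
     finite (verts C) \<and> edges C \<subseteq> verts C \<times> verts C \<and> acyclic (edges C) \<and>
     inputs C \<subseteq> verts C \<and> (\<forall>v\<in>inputs C. \<forall>u. (u, v) \<notin> edges C) \<and>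
     outputs C \<subseteq> verts C"

definition preds :: "'a cdag \<Rightarrow> 'a \<Rightarrow> 'a set" where
  "preds C v = {u. (u, v) \<in> edges C}"

definition induced :: "'a cdag \<Rightarrow> 'a set \<Rightarrow> 'a cdag" where
  "induced C W =
     \<lparr>inputs = inputs C \<inter> W, verts = W, edges = edges C \<inter> (W \<times> W), outputs = outputs C \<inter> W\<rparr>"

lemma is_cdag_induced:
  assumes "is_cdag C" "W \<subseteq> verts C"
  shows "is_cdag (induced C W)"
  using assms unfolding is_cdag_def induced_def
  by (auto intro: finite_subset acyclic_subset)

text \<open>
  The third rule of the game has two variants: \<open>Compute v\<close> places a fresh red pebble on \<open>v\<close>,
  and \<open>Slide u v\<close> moves the red pebble of the predecessor \<open>u\<close> to \<open>v\<close>.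
\<close>

datatype 'a move = Input 'a | Output 'a | Compute 'a | Slide 'a 'a | Delete 'a

text \<open>
  A configuration is a pair of the set of vertices carrying a red pebble and the set of vertices
  carrying a blue pebble.  All configurations reached from the initial one consist of subsets
  of the finite set \<open>verts C\<close>, so \<open>card\<close> is never applied to an infinite set there.
\<close>

inductive step :: "nat \<Rightarrow> 'a cdag \<Rightarrow> 'a set \<times> 'a set \<Rightarrow> 'a move \<Rightarrow> 'a set \<times> 'a set \<Rightarrow> bool"
  for S :: nat and C :: "'a cdag" where
  R1: "v \<in> B \<Longrightarrow> card (insert v R) \<le> S \<Longrightarrow> step S C (R, B) (Input v) (insert v R, B)"
| R2: "v \<in> R \<Longrightarrow> step S C (R, B) (Output v) (R, insert v B)"
| R3_place: "v \<in> verts C - inputs C \<Longrightarrow> preds C v \<subseteq> R \<Longrightarrow> card (insert v R) \<le> S \<Longrightarrow>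
    step S C (R, B) (Compute v) (insert v R, B)"
| R3_slide: "v \<in> verts C - inputs C \<Longrightarrow> preds C v \<subseteq> R \<Longrightarrow> u \<in> preds C v \<Longrightarrow>
    card (insert v (R - {u})) \<le> S \<Longrightarrow>
    step S C (R, B) (Slide u v) (insert v (R - {u}), B)"
| R4: "v \<in> R \<Longrightarrow> step S C (R, B) (Delete v) (R - {v}, B)"

inductive run :: "nat \<Rightarrow> 'a cdag \<Rightarrow> 'a set \<times> 'a set \<Rightarrow> 'a move list \<Rightarrow> 'a set \<times> 'a set \<Rightarrow> bool"
  for S :: nat and C :: "'a cdag" where
  Nil: "run S C s [] s"
| Cons: "step S C s m s' \<Longrightarrow> run S C s' ms s'' \<Longrightarrow> run S C s (m # ms) s''"

definition fired :: "'a move list \<Rightarrow> 'a \<Rightarrow> bool" where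
  "fired ms v \<longleftrightarrow> Compute v \<in> set ms \<or> (\<exists>u. Slide u v \<in> set ms)"

definition complete_calculation :: "nat \<Rightarrow> 'a cdag \<Rightarrow> 'a move list \<Rightarrow> bool" where
  "complete_calculation S C ms \<longleftrightarrow>
     (\<exists>R B. run S C ({}, inputs C) ms (R, B) \<and> outputs C \<subseteq> B) \<and>
     (\<forall>v \<in> verts C - inputs C. fired ms v)"

fun is_io :: "'a move \<Rightarrow> bool" where
  "is_io (Input v) = True"
| "is_io (Output v) = True"
| "is_io (Compute v) = False"
| "is_io (Slide u v) = False"
| "is_io (Delete v) = False"

definition cost :: "'a move list \<Rightarrow> nat" where
  "cost ms = length (filter is_io ms)"

text \<open>
  The infimum in \<^typ>\<open>enat\<close> is the minimum cost if a complete calculation exists.  If none exists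
  (\<open>S\<close> is too small for the graph), it is \<open>\<infinity>\<close>.
\<close>

definition io_complexity :: "nat \<Rightarrow> 'a cdag \<Rightarrow> enat" where
  "io_complexity S C = (INF ms \<in> {ms. complete_calculation S C ms}. enat (cost ms))"

lemma io_complexity_attained:
  assumes "complete_calculation S C ms"
  shows "\<exists>ms'. complete_calculation S C ms' \<and> io_complexity S C = enat (cost ms')"
proof -
  let ?A = "(\<lambda>ms. enat (cost ms)) ` {ms. complete_calculation S C ms}"
  have "Inf ?A \<in> ?A"
    using assms by (intro wellorder_InfI[of "enat (cost ms)"]) auto
  then show ?thesis
    unfolding io_complexity_def by auto
qed

definition io_lower_bound :: "nat \<Rightarrow> 'a cdag \<Rightarrow> real \<Rightarrow> bool" where
  "io_lower_bound S C L \<longleftrightarrow> ereal L \<le> ereal_of_enat (io_complexity S C)"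

end

theory Submission
  imports Defs
begin

text \<open>
  A complete calculation of \<open>C\<close> is projected onto each part \<open>W\<close>: moves outside \<open>W\<close> are dropped,
  and the configuration is intersected with \<open>W\<close>.  A slide across the boundary of \<open>W\<close> turns
  into a placement on its target or into a deletion at its source, neither of which costs
  anything.  The projections are complete calculations of the induced sub-CDAGs, and every
  input or output move survives in at most one of them.
\<close>

fun restrict_move :: "'a set \<Rightarrow> 'a move \<Rightarrow> 'a move list" where
  "restrict_move W (Input v) = (if v \<in> W then [Input v] else [])"
| "restrict_move W (Output v) = (if v \<in> W then [Output v] else [])"
| "restrict_move W (Compute v) = (if v \<in> W then [Compute v] else [])"
| "restrict_move W (Slide u v) =
     (if v \<in> W then if u \<in> W then [Slide u v] else [Compute v]
      else if u \<in> W then [Delete u] else [])"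
| "restrict_move W (Delete v) = (if v \<in> W then [Delete v] else [])"

definition restrict_moves :: "'a set \<Rightarrow> 'a move list \<Rightarrow> 'a move list" where
  "restrict_moves W ms = concat (map (restrict_move W) ms)"

section \<open>Runs, finiteness and predecessors in a sub-CDAG\<close>

lemma run_single: "step S C s m s' \<Longrightarrow> run S C s [m] s'"
  by (blast intro: run.intros)

lemma run_append: "run S C s ms s' \<Longrightarrow> run S C s' ms' s'' \<Longrightarrow> run S C s (ms @ ms') s''"
  by (induction rule: run.induct) (auto intro: run.intros)

lemma step_finite_red: "step S C s m s' \<Longrightarrow> finite (fst s) \<Longrightarrow> finite (fst s')"
  by (induction rule: step.induct) auto

lemma preds_induced: "v \<in> W \<Longrightarrow> preds (induced C W) v = preds C v \<inter> W"
  by (auto simp: preds_def induced_def)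

lemma induced_simps [simp]:
  "inputs (induced C W) = inputs C \<inter> W"
  "verts (induced C W) = W"
  "outputs (induced C W) = outputs C \<inter> W"
  by (simp_all add: induced_def)

text \<open>Every rule survives intersection with \<open>W\<close>: the red set only shrinks, so the
  bound \<open>S\<close> still holds; the predecessors of \<open>v\<close> inside \<open>W\<close>
  are among those in \<open>C\<close>; and a non-input of \<open>C\<close> is a non-input of the
  sub-CDAG.\<close>

lemma step_restrict:
  assumes "step S C (R, B) m (R', B')" and "finite R"
  shows "run S (induced C W) (R \<inter> W, B \<inter> W) (restrict_move W m) (R' \<inter> W, B' \<inter> W)"
proof -
  have fin: "finite R'"
    using step_finite_red[OF assms(1)] assms(2) by simp
  \<comment> \<open>Finiteness matters, since \<open>card\<close> is 0 on infinite sets and the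
    bound on \<open>R'\<close> would not pass to its subsets.\<close>
  then have card_le: "card (R' \<inter> W) \<le> card R'"
    by (intro card_mono) auto
  show ?thesis
    using assms(1)
  proof (cases rule: step.cases)
    case (R1 v)
    show ?thesis
    proof (cases "v \<in> W")
      case True
      have "step S (induced C W) (R \<inter> W, B \<inter> W) (Input v) (insert v (R \<inter> W), B \<inter> W)"
        using R1 True card_le by (intro step.R1) auto
      then show ?thesis
        using R1 True by (simp add: run_single)
    qed (use R1 in \<open>simp add: run.Nil\<close>)
  next
    case (R2 v)
    show ?thesis
    proof (cases "v \<in> W")
      case True
      have "step S (induced C W) (R \<inter> W, B \<inter> W) (Output v) (R \<inter> W, insert v (B \<inter> W))"
        using R2 True by (intro step.R2) auto
      then show ?thesis
        using R2 True by (simp add: run_single)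
    qed (use R2 in \<open>simp add: run.Nil\<close>)
  next
    case (R3_place v)
    show ?thesis
    proof (cases "v \<in> W")
      case True
      have "step S (induced C W) (R \<inter> W, B \<inter> W) (Compute v) (insert v (R \<inter> W), B \<inter> W)"
        using R3_place True card_le by (intro step.R3_place) (auto simp: preds_induced)
      then show ?thesis
        using R3_place True by (simp add: run_single)
    qed (use R3_place in \<open>simp add: run.Nil\<close>)
  next
    case (R3_slide v u)
    consider "v \<in> W" "u \<in> W" | "v \<in> W" "u \<notin> W" | "v \<notin> W" "u \<in> W" | "v \<notin> W" "u \<notin> W"
      by blast
    then show ?thesis
    proof cases
      case 1
      \<comment> \<open>Rewriting the projected red set as \<open>R' \<inter> W\<close> makes
        \<open>card_le\<close> applicable.\<close>
      have eq: "insert v (R \<inter> W - {u}) = R' \<inter> W"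
        using R3_slide 1 by auto
      have "step S (induced C W) (R \<inter> W, B \<inter> W) (Slide u v) (insert v (R \<inter> W - {u}), B \<inter> W)"
        using R3_slide 1 card_le by (intro step.R3_slide) (auto simp: preds_induced eq)
      then show ?thesis
        using R3_slide 1 by (simp only: eq) (simp add: run_single)
    next
      case 2
      \<comment> \<open>The pebble enters from outside, so nothing in \<open>W\<close> is lost. The
        added pebble respects the bound because the red set after the slide, \<open>R'\<close>,
        does.\<close>
      have eq: "insert v (R \<inter> W) = R' \<inter> W"
        using R3_slide 2 by auto
      have "step S (induced C W) (R \<inter> W, B \<inter> W) (Compute v) (insert v (R \<inter> W), B \<inter> W)"
        using R3_slide 2 card_le by (intro step.R3_place) (auto simp: preds_induced eq)
      then show ?thesis
        using R3_slide 2 by (simp only: eq) (simp add: run_single)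
    next
      case 3
      \<comment> \<open>The pebble leaves \<open>W\<close>. The deletion is legal because
        \<open>u\<close>, as a predecessor of \<open>v\<close>, carries a red pebble.\<close>
      have eq: "R \<inter> W - {u} = R' \<inter> W"
        using R3_slide 3 by auto
      have "step S (induced C W) (R \<inter> W, B \<inter> W) (Delete u) (R \<inter> W - {u}, B \<inter> W)"
        using R3_slide 3 by (intro step.R4) auto
      then show ?thesis
        using R3_slide 3 by (simp only: eq) (simp add: run_single)
    next
      case 4
      then have "R' \<inter> W = R \<inter> W"
        using R3_slide by auto
      then show ?thesis
        using R3_slide 4 by (simp add: run.Nil)
    qed
  next
    case (R4 v)
    show ?thesis
    proof (cases "v \<in> W")
      case True
      have eq: "R \<inter> W - {v} = R' \<inter> W"
        using R4 by auto
      have "step S (induced C W) (R \<inter> W, B \<inter> W) (Delete v) (R \<inter> W - {v}, B \<inter> W)"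
        using R4 True by (intro step.R4) auto
      then show ?thesis
        using R4 True by (simp only: eq) (simp add: run_single)
    next
      case False
      then have "R' \<inter> W = R \<inter> W"
        using R4 by auto
      then show ?thesis
        using R4 False by (simp add: run.Nil)
    qed
  qed
qed

lemma run_restrict:
  assumes "run S C s ms s'" and "finite (fst s)"
  shows "run S (induced C W) (fst s \<inter> W, snd s \<inter> W) (restrict_moves W ms)
    (fst s' \<inter> W, snd s' \<inter> W)"
  using assms
proof (induction rule: run.induct)
  case (Nil s)
  show ?case
    by (simp add: restrict_moves_def run.Nil)
next
  case (Cons s m s' ms s'')
  have "run S (induced C W) (fst s \<inter> W, snd s \<inter> W) (restrict_move W m)
      (fst s' \<inter> W, snd s' \<inter> W)"
    using Cons.hyps(1) Cons.prems by (intro step_restrict) simp_all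
  moreover have "run S (induced C W) (fst s' \<inter> W, snd s' \<inter> W) (restrict_moves W ms)
      (fst s'' \<inter> W, snd s'' \<inter> W)"
    using Cons.IH step_finite_red[OF Cons.hyps(1) Cons.prems] .
  ultimately show ?case
    by (simp add: restrict_moves_def run_append)
qed

text \<open>A slide onto \<open>v\<close> from outside \<open>W\<close> is kept as
  \<open>Compute v\<close>, so no firing inside \<open>W\<close> is lost.\<close>

lemma fired_restrict_moves:
  assumes "fired ms v" and "v \<in> W"
  shows "fired (restrict_moves W ms) v"
proof -
  obtain m where m: "m \<in> set ms" "m = Compute v \<or> (\<exists>u. m = Slide u v)"
    using assms(1) unfolding fired_def by blast
  have "\<exists>m'\<in>set (restrict_move W m). m' = Compute v \<or> (\<exists>u. m' = Slide u v)"
    using m(2) assms(2) by auto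
  then show ?thesis
    using m(1) unfolding fired_def restrict_moves_def by auto
qed

lemma complete_calculation_restrict:
  assumes "complete_calculation S C ms" and "W \<subseteq> verts C"
  shows "complete_calculation S (induced C W) (restrict_moves W ms)"
proof -
  obtain R B where "run S C ({}, inputs C) ms (R, B)" and out: "outputs C \<subseteq> B"
    using assms(1) unfolding complete_calculation_def by blast
  then have "run S (induced C W) ({}, inputs (induced C W)) (restrict_moves W ms)
      (R \<inter> W, B \<inter> W)"
    using run_restrict by fastforce
  moreover have "outputs (induced C W) \<subseteq> B \<inter> W"
    using out by auto
  moreover have "\<forall>v \<in> verts (induced C W) - inputs (induced C W). fired (restrict_moves W ms) v"
    using assms unfolding complete_calculation_def by (auto intro: fired_restrict_moves)
  ultimately show ?thesis
    unfolding complete_calculation_def by blast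
qed

section \<open>Cost of the projections onto disjoint parts\<close>

text \<open>The sum counts the parts that contain \<open>v\<close>.\<close>

lemma sum_indicator_disjoint_le:
  assumes "disjoint_family_on W I" and "finite I"
  shows "(\<Sum>i\<in>I. if v \<in> W i then 1 else 0 :: nat) \<le> 1"
proof -
  have "card {i\<in>I. v \<in> W i} \<le> Suc 0"
    using assms by (auto simp: card_le_Suc0_iff_eq disjoint_family_on_def)
  then show ?thesis
    using assms(2) by (simp add: sum.If_cases Int_def)
qed

text \<open>A slide projects to free moves only, so the left side counts the parts containing the
  vertex of an input or output move.\<close>

lemma sum_cost_restrict_move_le:
  assumes "disjoint_family_on W I" and "finite I"
  shows "(\<Sum>i\<in>I. cost (restrict_move (W i) m)) \<le> cost [m]"
proof -
  have "cost (restrict_move (W i) m) =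
      (case m of Input v \<Rightarrow> if v \<in> W i then 1 else 0 | Output v \<Rightarrow> if v \<in> W i then 1 else 0
       | _ \<Rightarrow> 0)" for i
    by (cases m) (auto simp: cost_def)
  then show ?thesis
    using sum_indicator_disjoint_le[OF assms] by (cases m) (simp_all add: cost_def)
qed

lemma sum_cost_restrict_moves_le:
  assumes "disjoint_family_on W I" and "finite I"
  shows "(\<Sum>i\<in>I. cost (restrict_moves (W i) ms)) \<le> cost ms"
proof (induction ms)
  case Nil
  show ?case
    by (simp add: restrict_moves_def cost_def)
next
  case (Cons m ms)
  have "(\<Sum>i\<in>I. cost (restrict_moves (W i) (m # ms))) =
      (\<Sum>i\<in>I. cost (restrict_move (W i) m)) + (\<Sum>i\<in>I. cost (restrict_moves (W i) ms))"
    by (simp add: restrict_moves_def cost_def sum.distrib)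
  also have "\<dots> \<le> cost [m] + cost ms"
    using sum_cost_restrict_move_le[OF assms] Cons.IH by (rule add_mono)
  also have "\<dots> = cost (m # ms)"
    by (simp add: cost_def)
  finally show ?case .
qed

section \<open>I/O complexities and lower bounds\<close>

text \<open>The estimate is made for an arbitrary complete calculation rather than an optimal one.
  This also covers the case where \<open>C\<close> has none, as its complexity is then
  \<open>\<infinity>\<close>.\<close>

lemma sum_io_complexity_induced_le:
  assumes "disjoint_family_on W I" and "finite I" and "\<And>i. i \<in> I \<Longrightarrow> W i \<subseteq> verts C"
  shows "(\<Sum>i\<in>I. io_complexity S (induced C (W i))) \<le> io_complexity S C"
  unfolding io_complexity_def[of S C]
proof (rule INF_greatest)
  fix ms
  assume "ms \<in> {ms. complete_calculation S C ms}"
  then have "io_complexity S (induced C (W i)) \<le> enat (cost (restrict_moves (W i) ms))"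
    if "i \<in> I" for i
    unfolding io_complexity_def
    using assms(3)[OF that] by (intro INF_lower) (simp add: complete_calculation_restrict)
  then have "(\<Sum>i\<in>I. io_complexity S (induced C (W i))) \<le>
      (\<Sum>i\<in>I. enat (cost (restrict_moves (W i) ms)))"
    by (rule sum_mono)
  also have "\<dots> = enat (\<Sum>i\<in>I. cost (restrict_moves (W i) ms))"
    using assms(2) by (induction I rule: finite_induct) (simp_all add: zero_enat_def)
  also have "\<dots> \<le> enat (cost ms)"
    using sum_cost_restrict_moves_le[OF assms(1,2)] by simp
  finally show "(\<Sum>i\<in>I. io_complexity S (induced C (W i))) \<le> enat (cost ms)" .
qed

lemma ereal_of_enat_sum: "ereal_of_enat (\<Sum>i\<in>I. f i) = (\<Sum>i\<in>I. ereal_of_enat (f i))"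
  by (induction I rule: infinite_finite_induct) (simp_all add: ereal_of_enat_add)

text \<open>Lower bounds are reals, possibly negative, while complexities may be infinite; both are
  compared in \<open>ereal\<close>, where sums are monotone.\<close>

lemma io_lower_bound_sum:
  assumes "(\<Sum>i\<in>I. io_complexity S (D i)) \<le> io_complexity S C"
    and "\<And>i. i \<in> I \<Longrightarrow> io_lower_bound S (D i) (L i)"
  shows "io_lower_bound S C (\<Sum>i\<in>I. L i)"
proof -
  have "ereal (\<Sum>i\<in>I. L i) = (\<Sum>i\<in>I. ereal (L i))"
    by simp
  also have "\<dots> \<le> (\<Sum>i\<in>I. ereal_of_enat (io_complexity S (D i)))"
    using assms(2) unfolding io_lower_bound_def by (rule sum_mono)
  also have "\<dots> \<le> ereal_of_enat (io_complexity S C)"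
    using assms(1) by (simp flip: ereal_of_enat_sum)
  finally show ?thesis
    unfolding io_lower_bound_def .
qed

theorem theorem2:
  fixes C :: "'a cdag" and S p :: nat and W :: "nat \<Rightarrow> 'a set"
  assumes "is_cdag C"
    and "S \<ge> 1"
    and "disjoint_family_on W {1..p}"
    and "(\<Union>i\<in>{1..p}. W i) = verts C"
  shows "(\<Sum>i=1..p. io_complexity S (induced C (W i))) \<le> io_complexity S C \<and>
    (\<forall>L :: nat \<Rightarrow> real.
       (\<forall>i\<in>{1..p}. io_lower_bound S (induced C (W i)) (L i)) \<longrightarrow>
       io_lower_bound S C (\<Sum>i=1..p. L i))"
proof -
  have sum_le: "(\<Sum>i=1..p. io_complexity S (induced C (W i))) \<le> io_complexity S C"
    \<comment> \<open>The covering hypothesis yields \<open>W i \<subseteq> verts C\<close> for each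
      part.\<close>
    using assms(3,4) by (intro sum_io_complexity_induced_le) auto
  then show ?thesis
    using io_lower_bound_sum[OF sum_le] by auto
qed

end
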